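(* Let $\langle\cdot,\cdot\rangle$ be an ELT inner product on $\overline{\mathcal R}^{\,n}$, let $S=\{v_1,\dots,v_k\}\subseteq\overline{\mathcal R}^{\,n}$ be an ELT orthonormal set of vectors, and let $v\in\overline{\mathcal R}^{\,n}$. Let $$u=\sum_{i=1}^{k}\langle v,v_i\rangle v_i .$$ Then $$\tau\left(\langle u,u\rangle\right)\leq\tau\left(\langle v,v\rangle\right).$$ Moreover, equality $\tau(\langle u,u\rangle)=\tau(\langle v,v\rangle)$ holds if and only if there is some $1\leq i\leq k$ such that $$\tau\left(\langle v,v_i\rangle^2\right)=\tau\left(\langle v,v\rangle\langle v_i,v_i\rangle\right)=\tau\left(\langle v,v\rangle\right).$$
   Context: The ELT algebra $\mathcal R=\mathscr R(\mathbb C,\mathbb R)$ is the set of symbols ${}^{[\ell]}a$ with $a\in\mathbb R$ (tangible value) and $\ell\in\mathbb C$ (layer), with multiplication ${}^{[\ell_1]}a_1\cdot{}^{[\ell_2]}a_2={}^{[\ell_1\ell_2]}(a_1+a_2)$ and addition ${}^{[\ell_1]}a_1+{}^{[\ell_2]}a_2$ equal to ${}^{[\ell_1]}a_1$ if $a_1>a_2$, to ${}^{[\ell_2]}a_2$ if $a_1<a_2$, and to ${}^{[\ell_1+\ell_2]}a_1$ if $a_1=a_2$. Put $\overline{\mathcal R}=\mathcal R\cup\{-\infty\}$, where $-\infty$ is a formal element with $-\infty+\alpha=\alpha+(-\infty)=\alpha$ and $-\infty\cdot\alpha=\alpha\cdot(-\infty)=-\infty$ for all $\alpha$. Layer map: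 $s({}^{[\ell]}a)=\ell$, $s(-\infty)=0$. Tangible value map: $\tau({}^{[\ell]}a)=a$, $\tau(-\infty)=-\infty$ (with $-\infty$ below every real number). Let $\mathcal R^\times=\{{}^{[\ell]}a\in\mathcal R:\ell\ne0\}$ and $\overline{\mathcal R^\times}=\mathcal R^\times\cup\{-\infty\}$. Conjugation: $\overline{{}^{[\ell]}a}={}^{[\overline\ell]}a$ and $\overline{-\infty}=-\infty$. An ELT inner product is a function $\langle\cdot,\cdot\rangle:\overline{\mathcal R}^{\,n}\times\overline{\mathcal R}^{\,n}\to\overline{\mathcal R}$ such that for all $u,v,w\in\overline{\mathcal R}^{\,n}$ and $a,b\in\overline{\mathcal R}$: (1) $\langle av+bu,w\rangle=a\langle v,w\rangle+b\langle u,w\rangle$; (2) $\langle v,u\rangle=\overline{\langle u,v\rangle}$; (3) $s(\langle v,v\rangle)$ is a real number $\geq0$, and if $v\in(\overline{\mathcal R^\times})^n$ then $s(\langle v,v\rangle)=0$ if and only if $v=(-\infty,\dots,-\infty)$. Vectors $u,v$ are ELT orthogonal, $u\perp v$, if $s(\langle u,v\rangle)=0$. A set $\{v_1,\dots,v_k\}$ ($k\ge1$) is ELT orthonormal if $v_i\perp v_j$ for all $i\neq j$ and $\langle v_i,v_i\rangle={}^{[1]}0$ for all $i$. *)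

theory Defs
  imports "HOL-Analysis.Finite_Cartesian_Product" "HOL-Library.Extended_Real" Complex_Main
begin

text \<open>
  The ELT algebra over the complex numbers (layers) and the reals (tangible values), with a
  formal bottom element adjoined: \<open>Layered l a\<close> is the symbol with layer \<open>l\<close> and tangible value
  \<open>a\<close>, and \<open>NegInf\<close> is the adjoined element. \<open>NegInf\<close> is the zero of the resulting semiring.
\<close>

datatype elt = NegInf | Layered complex real

fun elt_add :: "elt \<Rightarrow> elt \<Rightarrow> elt" where
  "elt_add NegInf y = y"
| "elt_add x NegInf = x"
| "elt_add (Layered l a) (Layered m b) =
     (if a > b then Layered l a else if a < b then Layered m b else Layered (l + m) a)"

fun elt_mult :: "elt \<Rightarrow> elt \<Rightarrow> elt" where
  "elt_mult NegInf y = NegInf"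
| "elt_mult x NegInf = NegInf"
| "elt_mult (Layered l a) (Layered m b) = Layered (l * m) (a + b)"

instantiation elt :: comm_semiring_1
begin

definition zero_elt_def: "0 = NegInf"
definition one_elt_def: "1 = Layered 1 0"
definition plus_elt_def: "x + y = elt_add x y"
definition times_elt_def: "x * y = elt_mult x y"

instance
proof
  fix a b c :: elt
  show "a + b + c = a + (b + c)"
    by (cases a; cases b; cases c) (auto simp: plus_elt_def)
  show "a + b = b + a"
    by (cases a; cases b) (auto simp: plus_elt_def)
  show "0 + a = a"
    by (simp add: plus_elt_def zero_elt_def)
  show "a * b * c = a * (b * c)"
    by (cases a; cases b; cases c) (auto simp: times_elt_def)
  show "a * b = b * a"
    by (cases a; cases b) (auto simp: times_elt_def)
  show "1 * a = a"
    by (cases a) (auto simp: times_elt_def one_elt_def)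
  show "(a + b) * c = a * c + b * c"
    by (cases a; cases b; cases c) (auto simp: times_elt_def plus_elt_def algebra_simps)
  show "0 * a = 0"
    by (simp add: times_elt_def zero_elt_def)
  show "a * 0 = 0"
    by (cases a) (auto simp: times_elt_def zero_elt_def)
  show "(0::elt) \<noteq> 1"
    by (simp add: zero_elt_def one_elt_def)
qed

end

fun layer :: "elt \<Rightarrow> complex" where
  "layer NegInf = 0"
| "layer (Layered l a) = l"

fun tangible :: "elt \<Rightarrow> ereal" where
  "tangible NegInf = -\<infinity>"
| "tangible (Layered l a) = ereal a"

fun elt_cnj :: "elt \<Rightarrow> elt" where
  "elt_cnj NegInf = NegInf"
| "elt_cnj (Layered l a) = Layered (cnj l) a"

definition nonzero_layer_closure :: "elt set" where
  "nonzero_layer_closure = {Layered l a | l a. l \<noteq> 0} \<union> {NegInf}"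

text \<open>
  Vectors have type \<open>elt ^ 'n\<close>. Their zero is the vector all of whose entries are \<open>NegInf\<close>.
\<close>

definition elt_inner_product :: "(elt ^ 'n \<Rightarrow> elt ^ 'n \<Rightarrow> elt) \<Rightarrow> bool" where
  "elt_inner_product ip \<longleftrightarrow>
     (\<forall>u v w a b. ip (a *s v + b *s u) w = a * ip v w + b * ip u w) \<and>
     (\<forall>u v. ip v u = elt_cnj (ip u v)) \<and>
     (\<forall>v. layer (ip v v) \<in> \<real> \<and> Re (layer (ip v v)) \<ge> 0) \<and>
     (\<forall>v. (\<forall>j. v $ j \<in> nonzero_layer_closure) \<longrightarrow> (layer (ip v v) = 0 \<longleftrightarrow> v = 0))"

definition elt_orthogonal :: "(elt ^ 'n \<Rightarrow> elt ^ 'n \<Rightarrow> elt) \<Rightarrow> elt ^ 'n \<Rightarrow> elt ^ 'n \<Rightarrow> bool" where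
  "elt_orthogonal ip u v \<longleftrightarrow> layer (ip u v) = 0"

text \<open>
  The set \<open>{x 1, \<dots>, x k}\<close> is given by its enumeration. Repetitions are impossible, since
  \<open>x i = x j\<close> with \<open>i \<noteq> j\<close> would give \<open>ip (x i) (x i)\<close> both layer 0 and layer 1.
\<close>

definition elt_orthonormal ::
  "(elt ^ 'n \<Rightarrow> elt ^ 'n \<Rightarrow> elt) \<Rightarrow> nat \<Rightarrow> (nat \<Rightarrow> elt ^ 'n) \<Rightarrow> bool" where
  "elt_orthonormal ip k x \<longleftrightarrow> k \<ge> 1 \<and>
     (\<forall>i\<in>{1..k}. \<forall>j\<in>{1..k}. i \<noteq> j \<longrightarrow> elt_orthogonal ip (x i) (x j)) \<and>
     (\<forall>i\<in>{1..k}. ip (x i) (x i) = Layered 1 0)"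

end

theory Submission imports Defs begin

text \<open>
  The tangible value turns sums into maxima and products into sums, so that tangible values
  never cancel: \<open>tangible (ip u w)\<close> is the largest tangible value of a term in the bilinear
  expansion of \<open>ip u w\<close>. Everything rests on a tropical Cauchy-Schwarz inequality,
  \<open>2 \<tau>\<langle>u, w\<rangle> \<le> \<tau>\<langle>u, u\<rangle> + \<tau>\<langle>w, w\<rangle>\<close>. For two unit vectors it follows from
  positivity: if the off-diagonal value were too large, a suitably scaled combination of the two
  would have its self-product dominated by the cross terms, whose layer can be made negative or is
  zero (\<open>cauchy_schwarz_axis\<close>). It passes to all linear combinations, because the dominant term
  of \<open>\<langle>u, w\<rangle>\<close> is bounded by diagonal terms of \<open>\<langle>u, u\<rangle>\<close> and \<open>\<langle>w, w\<rangle>\<close>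
  (\<open>cauchy_schwarz_combination\<close>). This detour through unit vectors is what covers vectors that
  have entries of layer zero, for which definiteness is not available.

  Applied to the vectors \<open>x i\<close>, the inequality says that the diagonal terms dominate
  \<open>\<langle>u, u\<rangle>\<close>, so \<open>\<tau>\<langle>u, u\<rangle> = max\<^sub>i 2 \<tau>\<langle>v, x i\<rangle>\<close>
  (\<open>tangible_self_product_combination\<close>). Applied to \<open>v\<close> and \<open>x i\<close>, it bounds each
  \<open>2 \<tau>\<langle>v, x i\<rangle>\<close> by \<open>\<tau>\<langle>v, v\<rangle>\<close>. Hence the inequality, with equality exactly when
  some \<open>i\<close> attains the bound.
\<close>

section \<open>Tangible values of sums and products\<close>

lemma tangible_add: "tangible (a + b) = max (tangible a) (tangible b)"
  by (cases a; cases b) (auto simp: plus_elt_def)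

lemma tangible_mult: "tangible (a * b) = tangible a + tangible b"
  by (cases a; cases b) (auto simp: times_elt_def)

lemma tangible_cnj [simp]: "tangible (elt_cnj a) = tangible a"
  by (cases a) auto

lemma tangible_le_sum:
  assumes "finite A" "i \<in> A"
  shows "tangible (f i) \<le> tangible (sum f A)"
  using assms by (induction A rule: finite_induct) (auto simp: tangible_add le_max_iff_disj)

lemma tangible_sum_attained:
  assumes "finite A" "A \<noteq> {}"
  shows "\<exists>i\<in>A. tangible (sum f A) = tangible (f i)"
  using assms
  by (induction A rule: finite_ne_induct) (auto simp: tangible_add max_def)

lemma elt_cnj_add: "elt_cnj (a + b) = elt_cnj a + elt_cnj b"
  by (cases a; cases b) (auto simp: plus_elt_def)

lemma elt_cnj_mult: "elt_cnj (a * b) = elt_cnj a * elt_cnj b"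
  by (cases a; cases b) (auto simp: times_elt_def)

section \<open>Sesquilinear expansion\<close>

lemma ip_cnj: "elt_inner_product ip \<Longrightarrow> ip w v = elt_cnj (ip v w)"
  unfolding elt_inner_product_def by blast

lemma ip_combine_left:
  "elt_inner_product ip \<Longrightarrow> ip (a *s v + b *s u) w = a * ip v w + b * ip u w"
  unfolding elt_inner_product_def by blast

lemma ip_combine_right:
  assumes "elt_inner_product ip"
  shows "ip w (a *s v + b *s u) = elt_cnj a * ip w v + elt_cnj b * ip w u"
  using ip_cnj[OF assms, of w] ip_combine_left[OF assms, of a v b u w]
  by (simp add: elt_cnj_add elt_cnj_mult)

lemma ip_zero_left:
  assumes "elt_inner_product ip"
  shows "ip 0 w = 0"
  using ip_combine_left[OF assms, of 0 0 0 0 w] by simp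

lemma ip_sum_left:
  assumes ip: "elt_inner_product ip" and "finite A"
  shows "ip (\<Sum>i\<in>A. a i *s f i) w = (\<Sum>i\<in>A. a i * ip (f i) w)"
  using assms(2)
proof (induction A rule: finite_induct)
  case empty
  then show ?case by (simp add: ip_zero_left[OF ip])
next
  case (insert i A)
  then show ?case
    using ip_combine_left[OF ip, of "a i" "f i" 1 "\<Sum>i\<in>A. a i *s f i" w] by simp
qed

lemma tangible_ip_swap:
  assumes "elt_inner_product ip"
  shows "tangible (ip v w) = tangible (ip w v)"
  using ip_cnj[OF assms, of v w] by simp

lemma tangible_ip_sum_left_attained:
  assumes "elt_inner_product ip" "finite A" "A \<noteq> {}"
  shows "\<exists>i\<in>A. tangible (ip (\<Sum>i\<in>A. a i *s f i) w) = tangible (a i) + tangible (ip (f i) w)"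
  using tangible_sum_attained[OF assms(2,3), of "\<lambda>i. a i * ip (f i) w"]
  by (simp add: ip_sum_left[OF assms(1,2)] tangible_mult)

lemma tangible_ip_sum_left_ge:
  assumes "elt_inner_product ip" "finite A" "i \<in> A"
  shows "tangible (a i) + tangible (ip (f i) w) \<le> tangible (ip (\<Sum>i\<in>A. a i *s f i) w)"
  using tangible_le_sum[OF assms(2,3), of "\<lambda>i. a i * ip (f i) w"]
  by (simp add: ip_sum_left[OF assms(1,2)] tangible_mult)

lemma tangible_ip_sum_sum_attained:
  assumes ip: "elt_inner_product ip" and "finite A" "A \<noteq> {}" "finite B" "B \<noteq> {}"
  shows "\<exists>i\<in>A. \<exists>j\<in>B. tangible (ip (\<Sum>i\<in>A. a i *s f i) (\<Sum>j\<in>B. b j *s g j)) =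
           tangible (a i) + (tangible (b j) + tangible (ip (f i) (g j)))"
  using tangible_ip_sum_left_attained[OF ip assms(2,3), of a f "\<Sum>j\<in>B. b j *s g j"]
    tangible_ip_sum_left_attained[OF ip assms(4,5), of b g "f _"]
  by (metis tangible_ip_swap[OF ip])

lemma tangible_self_product_ge_diagonal:
  assumes ip: "elt_inner_product ip" and "finite A" "i \<in> A"
  shows "tangible (a i) + (tangible (a i) + tangible (ip (f i) (f i)))
           \<le> tangible (ip (\<Sum>i\<in>A. a i *s f i) (\<Sum>i\<in>A. a i *s f i))"
proof -
  let ?u = "\<Sum>i\<in>A. a i *s f i"
  have "tangible (a i) + tangible (ip (f i) (f i)) \<le> tangible (ip (f i) ?u)"
    using tangible_ip_sum_left_ge[OF assms, of a f "f i"] tangible_ip_swap[OF ip] by metis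
  then have "tangible (a i) + (tangible (a i) + tangible (ip (f i) (f i)))
      \<le> tangible (a i) + tangible (ip (f i) ?u)"
    by (rule add_left_mono)
  also have "\<dots> \<le> tangible (ip ?u ?u)"
    by (rule tangible_ip_sum_left_ge[OF assms])
  finally show ?thesis .
qed

section \<open>The tropical Cauchy-Schwarz inequality\<close>

text \<open>
  The doubled value is written as a sum of two copies, so that it rearranges by associativity and
  commutativity alone, also when some of the values are \<open>-\<infinity>\<close>.
\<close>

definition tropical_cauchy_schwarz ::
  "(elt ^ 'n \<Rightarrow> elt ^ 'n \<Rightarrow> elt) \<Rightarrow> elt ^ 'n \<Rightarrow> elt ^ 'n \<Rightarrow> bool" where
  "tropical_cauchy_schwarz ip v w \<longleftrightarrow>
     tangible (ip v w) + tangible (ip v w) \<le> tangible (ip v v) + tangible (ip w w)"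

text \<open>
  The dominant term of \<open>ip v w\<close> involves a single pair \<open>(f i, g j)\<close>, and the inequality
  for that pair bounds twice this term by one diagonal term of \<open>ip v v\<close> plus one of \<open>ip w w\<close>.
\<close>

lemma cauchy_schwarz_combination:
  assumes ip: "elt_inner_product ip" and A: "finite A" "A \<noteq> {}" and B: "finite B" "B \<noteq> {}"
    and cs: "\<And>i j. i \<in> A \<Longrightarrow> j \<in> B \<Longrightarrow> tropical_cauchy_schwarz ip (f i) (g j)"
  shows "tropical_cauchy_schwarz ip (\<Sum>i\<in>A. a i *s f i) (\<Sum>j\<in>B. b j *s g j)"
proof -
  let ?v = "\<Sum>i\<in>A. a i *s f i" and ?w = "\<Sum>j\<in>B. b j *s g j"
  obtain i j where ij: "i \<in> A" "j \<in> B"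
    and eq: "tangible (ip ?v ?w) = tangible (a i) + (tangible (b j) + tangible (ip (f i) (g j)))"
    using tangible_ip_sum_sum_attained[OF ip A B, of a f b g] by blast
  have "tangible (ip ?v ?w) + tangible (ip ?v ?w)
      = (tangible (a i) + tangible (a i) + (tangible (b j) + tangible (b j)))
          + (tangible (ip (f i) (g j)) + tangible (ip (f i) (g j)))"
    unfolding eq by (simp add: ac_simps)
  also have "\<dots> \<le> (tangible (a i) + tangible (a i) + (tangible (b j) + tangible (b j)))
          + (tangible (ip (f i) (f i)) + tangible (ip (g j) (g j)))"
    using cs[OF ij] unfolding tropical_cauchy_schwarz_def by (rule add_left_mono)
  also have "\<dots> = (tangible (a i) + (tangible (a i) + tangible (ip (f i) (f i))))
          + (tangible (b j) + (tangible (b j) + tangible (ip (g j) (g j))))"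
    by (simp add: ac_simps)
  also have "\<dots> \<le> tangible (ip ?v ?v) + tangible (ip ?w ?w)"
    by (intro add_mono tangible_self_product_ge_diagonal[OF ip] A B ij)
  finally show ?thesis
    unfolding tropical_cauchy_schwarz_def .
qed

lemma nonzero_layer_closure_simps [simp]:
  "NegInf \<in> nonzero_layer_closure"
  "Layered l a \<in> nonzero_layer_closure \<longleftrightarrow> l \<noteq> 0"
  by (auto simp: nonzero_layer_closure_def)

lemma unit_vector_layer_nonzero:
  assumes "elt_inner_product ip"
  shows "layer (ip (axis i 1) (axis i 1)) \<noteq> 0"
proof -
  have "axis i (1::elt) $ j \<in> nonzero_layer_closure" for j
    by (auto simp: axis_def zero_elt_def one_elt_def)
  moreover have "axis i (1::elt) \<noteq> 0"
    by (auto simp: axis_def vec_eq_iff)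
  ultimately show ?thesis
    using assms unfolding elt_inner_product_def by blast
qed

text \<open>
  Write \<open>A\<close>, \<open>B\<close> for the tangible values on the diagonal and \<open>Layered l c\<close> for the
  off-diagonal product. If \<open>2 c > A + B\<close>, then in the self-product of
  \<open>Layered 1 ((B - A) / 2) *s axis i 1 + Layered m 0 *s axis j 1\<close> both square terms have
  tangible value \<open>B\<close>, the cross terms have the larger value \<open>(B - A) / 2 + c\<close>, and their
  layers add up to \<open>cnj m * l + m * cnj l\<close>. For \<open>l \<noteq> 0\<close> the choice \<open>m = - l\<close> makes this
  negative; for \<open>l = 0\<close> it vanishes, against definiteness.
\<close>

lemma cauchy_schwarz_axis:
  fixes ip :: "elt ^ 'n \<Rightarrow> elt ^ 'n \<Rightarrow> elt"
  assumes ip: "elt_inner_product ip"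
  shows "tropical_cauchy_schwarz ip (axis i 1) (axis j 1)"
proof (cases "i = j")
  case True
  then show ?thesis by (simp add: tropical_cauchy_schwarz_def)
next
  case False
  let ?e = "axis i 1 :: elt ^ 'n" and ?f = "axis j 1 :: elt ^ 'n"
  obtain p A where ee: "ip ?e ?e = Layered p A"
    using unit_vector_layer_nonzero[OF ip, of i] by (cases "ip ?e ?e") auto
  obtain q B where ff: "ip ?f ?f = Layered q B"
    using unit_vector_layer_nonzero[OF ip, of j] by (cases "ip ?f ?f") auto
  show ?thesis
  proof (rule ccontr)
    assume "\<not> ?thesis"
    then obtain l c where ef: "ip ?e ?f = Layered l c" and large: "A + B < c + c"
      by (cases "ip ?e ?f") (auto simp: tropical_cauchy_schwarz_def ee ff)
    have fe: "ip ?f ?e = Layered (cnj l) c"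
      using ip_cnj[OF ip, of ?f ?e] ef by simp
    define m where "m = (if l = 0 then 1 else - l)"
    define w where "w = Layered 1 ((B - A) / 2) *s ?e + Layered m 0 *s ?f"
    have m: "m \<noteq> 0"
      by (simp add: m_def)
    have "w $ h \<in> nonzero_layer_closure" for h
      using False m
      by (auto simp: w_def axis_def plus_elt_def times_elt_def
          zero_elt_def one_elt_def)
    moreover have "w \<noteq> 0"
    proof
      assume "w = 0"
      then have "w $ i = 0" by simp
      then show False
        using False
        by (simp add: w_def axis_def plus_elt_def times_elt_def zero_elt_def one_elt_def)
    qed
    ultimately have nz: "layer (ip w w) \<noteq> 0"
      using ip unfolding elt_inner_product_def by blast
    have "ip w w = Layered (cnj m * l + m * cnj l) ((B - A) / 2 + c)"
      using large unfolding w_def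
      by (simp add: ip_combine_left[OF ip] ip_combine_right[OF ip] ee ff ef fe
          plus_elt_def times_elt_def field_simps)
    then have layer_w: "layer (ip w w) = cnj m * l + m * cnj l"
      by simp
    have "l \<noteq> 0"
      using nz layer_w by auto
    then have "Re (layer (ip w w)) = - 2 * ((Re l)\<^sup>2 + (Im l)\<^sup>2)"
      by (simp add: layer_w m_def power2_eq_square)
    also have "\<dots> < 0"
      using \<open>l \<noteq> 0\<close> by (intro mult_neg_pos) (simp_all add: complex_neq_0)
    finally have "Re (layer (ip w w)) < 0" .
    moreover have "Re (layer (ip w w)) \<ge> 0"
      using ip unfolding elt_inner_product_def by blast
    ultimately show False by simp
  qed
qed

lemma elt_vector_expansion:
  fixes v :: "elt ^ 'n"
  shows "v = (\<Sum>i\<in>UNIV. v $ i *s axis i 1)"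
  by (simp add: vec_eq_iff axis_def if_distrib cong: if_cong)

lemma cauchy_schwarz_tangible:
  fixes ip :: "elt ^ 'n \<Rightarrow> elt ^ 'n \<Rightarrow> elt"
  assumes ip: "elt_inner_product ip"
  shows "tropical_cauchy_schwarz ip v w"
  using cauchy_schwarz_combination[OF ip, of UNIV UNIV "\<lambda>i. axis i 1" "\<lambda>i. axis i 1"
      "\<lambda>i. v $ i" "\<lambda>i. w $ i"] cauchy_schwarz_axis[OF ip]
  by (simp flip: elt_vector_expansion)

lemma ereal_le_of_double_le:
  fixes s t :: ereal
  assumes "s + s \<le> t + t"
  shows "s \<le> t"
  using assms by (cases s; cases t) auto

section \<open>The self-product of a linear combination\<close>

text \<open>
  The dominant term of the self-product may sit off the diagonal, at \<open>(i, j)\<close>; by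
  Cauchy-Schwarz twice its value is at most the sum of the diagonal values at \<open>i\<close> and \<open>j\<close>, so
  the larger of these two dominates as well.
\<close>

lemma tangible_self_product_combination:
  assumes ip: "elt_inner_product ip" and A: "finite A" "A \<noteq> {}"
    and u: "u = (\<Sum>i\<in>A. a i *s f i)"
  shows "\<exists>i\<in>A. tangible (ip u u) = tangible (a i) + (tangible (a i) + tangible (ip (f i) (f i)))"
proof -
  define d where "d i = tangible (a i) + (tangible (a i) + tangible (ip (f i) (f i)))" for i
  have ge: "d i \<le> tangible (ip u u)" if "i \<in> A" for i
    unfolding d_def u by (rule tangible_self_product_ge_diagonal[OF ip A(1) that])
  obtain i j where ij: "i \<in> A" "j \<in> A"
    and eq: "tangible (ip u u) = tangible (a i) + (tangible (a j) + tangible (ip (f i) (f j)))"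
    using tangible_ip_sum_sum_attained[OF ip A A, of a f a f] unfolding u by blast
  have "tangible (ip u u) + tangible (ip u u)
      = (tangible (a i) + tangible (a i) + (tangible (a j) + tangible (a j)))
          + (tangible (ip (f i) (f j)) + tangible (ip (f i) (f j)))"
    unfolding eq by (simp add: ac_simps)
  also have "\<dots> \<le> (tangible (a i) + tangible (a i) + (tangible (a j) + tangible (a j)))
          + (tangible (ip (f i) (f i)) + tangible (ip (f j) (f j)))"
    using cauchy_schwarz_tangible[OF ip, of "f i" "f j"]
    unfolding tropical_cauchy_schwarz_def by (rule add_left_mono)
  also have "\<dots> = d i + d j"
    by (simp add: d_def ac_simps)
  also have "\<dots> \<le> max (d i) (d j) + max (d i) (d j)"
    by (intro add_mono) auto
  finally have "tangible (ip u u) \<le> max (d i) (d j)"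
    by (rule ereal_le_of_double_le)
  then have "tangible (ip u u) = d i \<or> tangible (ip u u) = d j"
    using ge[OF ij(1)] ge[OF ij(2)] by (auto simp: max_def split: if_splits)
  then show ?thesis
    using ij unfolding d_def by blast
qed

theorem theorem3p21:
  fixes ip :: "elt ^ 'n \<Rightarrow> elt ^ 'n \<Rightarrow> elt"
    and k :: nat
    and x :: "nat \<Rightarrow> elt ^ 'n"
    and u v :: "elt ^ 'n"
  assumes "elt_inner_product ip"
    and "elt_orthonormal ip k x"
    and "u = (\<Sum>i=1..k. ip v (x i) *s x i)"
  shows "tangible (ip u u) \<le> tangible (ip v v) \<and>
         (tangible (ip u u) = tangible (ip v v) \<longleftrightarrow>
           (\<exists>i\<in>{1..k}. tangible ((ip v (x i))\<^sup>2) = tangible (ip v v * ip (x i) (x i)) \<and>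
                      tangible (ip v v * ip (x i) (x i)) = tangible (ip v v)))"
proof -
  let ?I = "{1..k}"
  define d where "d i = tangible (ip v (x i)) + tangible (ip v (x i))" for i
  have unit: "tangible (ip (x i) (x i)) = 0" if "i \<in> ?I" for i
    using assms(2) that by (auto simp: elt_orthonormal_def zero_ereal_def)
  have I: "finite ?I" "?I \<noteq> {}"
    using assms(2) by (auto simp: elt_orthonormal_def)
  have bound: "d i \<le> tangible (ip v v)" if "i \<in> ?I" for i
    using cauchy_schwarz_tangible[OF assms(1), of v "x i"]
    by (simp add: tropical_cauchy_schwarz_def d_def unit[OF that])
  have below: "d i \<le> tangible (ip u u)" if "i \<in> ?I" for i
    using tangible_self_product_ge_diagonal[OF assms(1) I(1) that, of "\<lambda>i. ip v (x i)" x]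
    by (simp add: assms(3) d_def unit[OF that])
  obtain i where i: "i \<in> ?I" and attained: "tangible (ip u u) = d i"
    using tangible_self_product_combination[OF assms(1) I assms(3)] unit
    by (auto simp: d_def)
  have "(\<exists>i\<in>?I. tangible ((ip v (x i))\<^sup>2) = tangible (ip v v * ip (x i) (x i)) \<and>
                      tangible (ip v v * ip (x i) (x i)) = tangible (ip v v))
      \<longleftrightarrow> (\<exists>i\<in>?I. d i = tangible (ip v v))"
    using unit by (auto simp: tangible_mult d_def power2_eq_square)
  moreover have "tangible (ip u u) = tangible (ip v v) \<longleftrightarrow> (\<exists>i\<in>?I. d i = tangible (ip v v))"
    using i attained bound below by (metis order_antisym)
  moreover have "tangible (ip u u) \<le> tangible (ip v v)"
    using attained bound[OF i] by simp
  ultimately show ?thesis by blast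
qed

end
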